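(* Let $G=(V,E,\tau)$ be a temporal graph, $s,z\in V$ distinct, and $F(G)$ its flattening with respect to $s,z$. Then: (1) if $S$ is an $(s,z)$-temporal separator in $G$, then there is an $(s,z)$-separator of size at most $\tau|S|$ in $F(G)$; (2) if $S'$ is an $(s,z)$-separator in $F(G)$, then there is an $(s,z)$-temporal separator of size at most $|S'|$ in $G$.
   Context: A temporal graph $G=(V,E,\tau)$ consists of a finite vertex set $V$ and a set of time-labelled undirected edges $E \subseteq V\times V\times[\tau]$ ($(u,v,t')\in E$ iff $(v,u,t')\in E$, no loops). An $(s,z)$-temporal path is a sequence of edges $(u_1,v_1,t_1),\dots,(u_k,v_k,t_k)$ forming a path from $s$ to $z$ with $t_1\le\dots\le t_k$. An $(s,z)$-temporal separator is a set $S\subseteq V\setminus\{s,z\}$ containing a vertex of every $(s,z)$-temporal path. Writing $V\setminus\{s,z\}=\{v_1,\dots,v_n\}$, the flattening $F(G)$ is the static directed graph with vertex set $\{s,z\}\cup\{v_{j,i}: j\in[n], i\in[\tau]\}$ and arcs: $(v_{i,t'},v_{j,t'})$ and $(v_{j,t'},v_{i,t'})$ for each $(v_i,v_j,t')\in E$ with $v_i,v_j\notin\{s,z\}$; $(v_{i,t'},v_{i,t'+1})$ for every $i$ and $t'\in[\tau-1]$; $(s,v_{i,t'})$ for each $(s,v_i,t')\in E$; and $(v_{i,t'},z)$ for each $(z,v_i,t')\in E$. An $(s,z)$-separator in a directed graph is a set of vertices other than $s,z$ whose removal destroys all directed paths from $s$ to $z$.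
   Formalization: Part (2) is stated under the added assumption that no time-edge joins s and z directly; otherwise no temporal separator exists in G, while F(G), having no arc from s to z, always has a separator, so (2) is false. *)

theory Defs
  imports "Graph_Theory.Graph_Theory"
begin

record 'a temporal_graph =
  tverts :: "'a set"
  tedges :: "('a \<times> 'a \<times> nat) set"
  lifetime :: nat

text \<open>An undirected time-edge between \<open>u\<close> and \<open>v\<close> is stored in both orientations.\<close>

locale temporal_graph =
  fixes G :: "'a temporal_graph"
  assumes finite_tverts: "finite (tverts G)"
    and tedges_subset: "tedges G \<subseteq> tverts G \<times> tverts G \<times> {1..lifetime G}"
    and tedges_sym: "(u, v, t) \<in> tedges G \<longleftrightarrow> (v, u, t) \<in> tedges G"
    and no_loops: "(u, u, t) \<notin> tedges G"

definition underlying_digraph :: "'a temporal_graph \<Rightarrow> ('a, 'a \<times> 'a \<times> nat) pre_digraph" where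
  "underlying_digraph G =
     \<lparr> verts = tverts G, arcs = tedges G, tail = (\<lambda>(u, v, t). u), head = (\<lambda>(u, v, t). v) \<rparr>"

text \<open>Paths do not repeat vertices; the time labels only need to be nondecreasing.\<close>

definition temporal_path ::
  "'a temporal_graph \<Rightarrow> 'a \<Rightarrow> ('a \<times> 'a \<times> nat) list \<Rightarrow> 'a \<Rightarrow> bool" where
  "temporal_path G s es z \<longleftrightarrow>
     pre_digraph.apath (underlying_digraph G) s es z \<and> sorted (map (\<lambda>(u, v, t). t) es)"

definition temporal_separator :: "'a temporal_graph \<Rightarrow> 'a \<Rightarrow> 'a \<Rightarrow> 'a set \<Rightarrow> bool" where
  "temporal_separator G s z S \<longleftrightarrow>
     S \<subseteq> tverts G - {s, z} \<and>
     (\<forall>es. temporal_path G s es z \<longrightarrow>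
       S \<inter> set (pre_digraph.awalk_verts (underlying_digraph G) s es) \<noteq> {})"

definition digraph_separator :: "('a, 'b) pre_digraph \<Rightarrow> 'a \<Rightarrow> 'a \<Rightarrow> 'a set \<Rightarrow> bool" where
  "digraph_separator D s z S \<longleftrightarrow>
     S \<subseteq> verts D - {s, z} \<and>
     \<not> (\<exists>p. pre_digraph.apath (D \<restriction> (verts D - S)) s p z)"

text \<open>
  The copy \<open>v\<^sub>j\<^sub>,\<^sub>i\<close> of an inner vertex is \<open>Copy v\<^sub>j i\<close>; the inner vertices are not
  enumerated but serve as their own indices.
\<close>

datatype 'a flat_vertex = Terminal 'a | Copy 'a nat

definition inner_verts :: "'a temporal_graph \<Rightarrow> 'a \<Rightarrow> 'a \<Rightarrow> 'a set" where
  "inner_verts G s z = tverts G - {s, z}"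

text \<open>
  The first set of arcs contains both orientations of each undirected time-edge because
  \<^const>\<open>tedges\<close> is symmetric. A time-edge joining \<open>s\<close> and \<open>z\<close> directly contributes no arc.
\<close>

definition flattening ::
  "'a temporal_graph \<Rightarrow> 'a \<Rightarrow> 'a \<Rightarrow> 'a flat_vertex pair_pre_digraph" where
  "flattening G s z =
     \<lparr> pverts = {Terminal s, Terminal z} \<union>
         {Copy v i | v i. v \<in> inner_verts G s z \<and> i \<in> {1..lifetime G}},
       parcs =
         {(Copy u t, Copy v t) | u v t.
            (u, v, t) \<in> tedges G \<and> u \<in> inner_verts G s z \<and> v \<in> inner_verts G s z} \<union>
         {(Copy v t, Copy v (t + 1)) | v t.
            v \<in> inner_verts G s z \<and> t \<in> {1..<lifetime G}} \<union>
         {(Terminal s, Copy v t) | v t. (s, v, t) \<in> tedges G \<and> v \<in> inner_verts G s z} \<union>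
         {(Copy v t, Terminal z) | v t. (z, v, t) \<in> tedges G \<and> v \<in> inner_verts G s z} \<rparr>"

end

theory Submission
  imports Defs
begin

text \<open>
  A walk from \<open>s\<close> in the flattening projects to a temporal walk in \<open>G\<close>, the arcs from
  \<open>v\<^sub>j\<^sub>,\<^sub>i\<close> to \<open>v\<^sub>j\<^sub>,\<^sub>i\<^sub>+\<^sub>1\<close> being waiting steps; conversely a temporal walk lifts after waiting at
  each vertex for its next time-edge. Hence all copies of the vertices of a temporal separator
  separate \<open>s\<close> from \<open>z\<close> in the flattening, and the vertices having some copy in a separator of
  the flattening form a temporal separator.
\<close>

lemma underlying_digraph_simps [simp]:
  "verts (underlying_digraph G) = tverts G"
  "arcs (underlying_digraph G) = tedges G"
  "tail (underlying_digraph G) (u, v, t) = u"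
  "head (underlying_digraph G) (u, v, t) = v"
  by (simp_all add: underlying_digraph_def)

sublocale temporal_graph \<subseteq> underlying: wf_digraph "underlying_digraph G"
  using tedges_subset by unfold_locales (auto simp: underlying_digraph_def)

text \<open>The counterpart in \<open>G\<close> of reaching \<open>Copy v t\<close> in the
  flattening. The time \<open>t\<close> bounds the labels from above instead of being the last
  label, so waiting at \<open>v\<close> until \<open>t\<close> is built in.\<close>

definition temporally_reachable ::
  "'a temporal_graph \<Rightarrow> 'a set \<Rightarrow> 'a \<Rightarrow> 'a \<Rightarrow> nat \<Rightarrow> bool" where
  "temporally_reachable G S s v t \<longleftrightarrow>
     (\<exists>es. temporal_path G s es v \<and> (\<forall>(x, y, i) \<in> set es. i \<le> t) \<and>
       S \<inter> set (pre_digraph.awalk_verts (underlying_digraph G) s es) = {})"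

lemma temporally_reachable_mono:
  "temporally_reachable G S s v t \<Longrightarrow> t \<le> t' \<Longrightarrow> temporally_reachable G S s v t'"
  unfolding temporally_reachable_def by fastforce

context temporal_graph
begin

lemma temporally_reachable_refl:
  "s \<in> tverts G \<Longrightarrow> s \<notin> S \<Longrightarrow> temporally_reachable G S s s t"
  unfolding temporally_reachable_def temporal_path_def
  by (intro exI[of _ "[]"]) (simp add: underlying.apath_Nil_iff)

text \<open>The label \<open>t\<close> of the new edge is at least every earlier label, so appending
  the edge keeps the labels sorted. Appending may revisit \<open>v\<close>; in that case the part of
  the old path up to \<open>v\<close> already serves.\<close>

lemma temporally_reachable_step:
  assumes "temporally_reachable G S s u t" and edge: "(u, v, t) \<in> tedges G" and "v \<notin> S"
  shows "temporally_reachable G S s v t"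
proof -
  obtain es where path: "underlying.apath s es u" and sorted: "sorted (map (\<lambda>(x, y, i). i) es)"
    and times: "\<forall>(x, y, i) \<in> set es. i \<le> t"
    and avoid: "S \<inter> set (underlying.awalk_verts s es) = {}"
    using assms(1) unfolding temporally_reachable_def temporal_path_def by blast
  have walk: "underlying.awalk s es u"
    using path by (rule underlying.awalkI_apath)
  show ?thesis
  proof (cases "v \<in> set (underlying.awalk_verts s es)")
    case True
    \<comment> \<open>The prefix \<open>q\<close> ending at \<open>v\<close> inherits sortedness,
      the bound \<open>t\<close> and avoidance of \<open>S\<close>.\<close>
    then obtain q r where qr: "es = q @ r" "underlying.awalk s q v" "underlying.awalk v r u"
      using underlying.awalk_decomp[OF walk] by blast
    then have last: "underlying.awlast s q = v"
      by auto
    have "underlying.apath s q v"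
      using path qr(1) last by (simp add: underlying.apath_append_iff)
    moreover have "set (underlying.awalk_verts s q) \<subseteq> set (underlying.awalk_verts s es)"
      using underlying.set_awalk_verts_append[OF qr(2,3)] qr(1) by blast
    ultimately show ?thesis
      using sorted times avoid qr(1)
      unfolding temporally_reachable_def temporal_path_def
      by (intro exI[of _ q]) (auto simp: sorted_append)
  next
    case False
    have last: "underlying.awlast s es = u"
      using walk by auto
    have "u \<noteq> v" and "v \<in> tverts G" and "u \<in> tverts G"
      using edge no_loops tedges_subset by auto
    then have arc: "underlying.apath u [(u, v, t)] v"
      using edge by (simp add: underlying.apath_simps)
    have "underlying.apath s (es @ [(u, v, t)]) v"
      using path arc last False by (simp add: underlying.apath_append_iff)
    moreover have "set (underlying.awalk_verts s (es @ [(u, v, t)])) =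
        set (underlying.awalk_verts s es) \<union> {u, v}"
      using underlying.set_awalk_verts_append[OF walk underlying.awalkI_apath[OF arc]] by simp
    \<comment> \<open>As \<open>u\<close> is the end of the old path, the only new vertex is
      \<open>v\<close>, which lies outside \<open>S\<close>.\<close>
    moreover have "u \<in> set (underlying.awalk_verts s es)"
      using last by (metis last_in_set underlying.awalk_verts_non_Nil)
    ultimately show ?thesis
      using sorted times avoid \<open>v \<notin> S\<close>
      unfolding temporally_reachable_def temporal_path_def
      by (intro exI[of _ "es @ [(u, v, t)]"]) (auto simp: sorted_append)
  qed
qed

lemma wf_digraph_flattening: "wf_digraph (with_proj (flattening G s z))"
  using tedges_subset
  by unfold_locales (fastforce simp: flattening_def)+

text \<open>In a well-formed digraph every walk shortens to a path, so the absence of paths is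
  unreachability. Arguments about separators can then work with reachability, where repeated
  vertices do no harm.\<close>

lemma digraph_separator_flattening_iff:
  "digraph_separator (with_proj (flattening G s z)) a b S \<longleftrightarrow>
     S \<subseteq> pverts (flattening G s z) - {a, b} \<and>
     \<not> a \<rightarrow>\<^sup>*\<^bsub>with_proj (flattening G s z) \<restriction> (pverts (flattening G s z) - S)\<^esub> b"
  using wf_digraph.reachable_apath
    [OF wf_digraph.wellformed_induce_subgraph[OF wf_digraph_flattening]]
  by (simp add: digraph_separator_def)

end

lemma dominates_induce_with_proj_iff:
  "x \<rightarrow>\<^bsub>with_proj H \<restriction> A\<^esub> y \<longleftrightarrow> (x, y) \<in> parcs H \<and> x \<in> A \<and> y \<in> A"
  by (auto simp: arcs_ends_def arc_to_ends_def image_iff)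

text \<open>Time indices never decrease along arcs between copies, so the index of the current copy
  bounds all labels used so far. A walk to \<open>Terminal z\<close> avoiding the copies of
  \<open>S\<close> would thus yield a temporal path avoiding \<open>S\<close>.\<close>

lemma (in temporal_graph) flattening_separator_of_temporal_separator:
  assumes "s \<in> tverts G" and "s \<noteq> z" and sep: "temporal_separator G s z S"
  shows "digraph_separator (with_proj (flattening G s z)) (Terminal s) (Terminal z)
    (case_prod Copy ` (S \<times> {1..lifetime G}))"
proof -
  define S' where "S' = case_prod Copy ` (S \<times> {1..lifetime G})"
  define H where "H = with_proj (flattening G s z) \<restriction> (pverts (flattening G s z) - S')"
  have S: "S \<subseteq> tverts G - {s, z}"
    using sep by (simp add: temporal_separator_def)
  interpret H: wf_digraph H
    unfolding H_def by (intro wf_digraph.wellformed_induce_subgraph wf_digraph_flattening)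
  \<comment> \<open>The invariant along walks from \<open>Terminal s\<close>; terminals carry no
    time index, hence the existential quantifier there.\<close>
  have reach: "case y of
      Terminal v \<Rightarrow> (\<exists>t. temporally_reachable G S s v t)
    | Copy v t \<Rightarrow> temporally_reachable G S s v t"
    if "Terminal s \<rightarrow>\<^sup>*\<^bsub>H\<^esub> y" for y
    using that
  proof (induction rule: H.reachable_induct)
    case base
    then show ?case
      using assms(1) S temporally_reachable_refl[of s S 0] by auto
  next
    case (step x y)
    have arc: "(x, y) \<in> parcs (flattening G s z)" and y: "y \<in> pverts (flattening G s z) - S'"
      using step.hyps unfolding H_def dominates_induce_with_proj_iff by auto
    \<comment> \<open>The index of a copy in the flattening lies in \<open>{1..lifetime G}\<close>,
      so a copy of a vertex of \<open>S\<close> would be in \<open>S'\<close>.\<close>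
    have notin: "v \<notin> S" if "y = Copy v t" for v t
      using y that unfolding S'_def flattening_def by auto
    from arc consider
        (edge) u v t where "x = Copy u t" "y = Copy v t" "(u, v, t) \<in> tedges G"
      | (wait) v t where "x = Copy v t" "y = Copy v (t + 1)"
      | (start) v t where "x = Terminal s" "y = Copy v t" "(s, v, t) \<in> tedges G"
      | (finish) v t where "x = Copy v t" "y = Terminal z" "(v, z, t) \<in> tedges G"
      using tedges_sym unfolding flattening_def by auto
    then show ?case
    proof cases
      case edge
      then show ?thesis
        using step.IH notin by (auto intro: temporally_reachable_step)
    next
      case wait
      then show ?thesis
        using step.IH by (auto intro: temporally_reachable_mono)
    next
      case start
      \<comment> \<open>The induction hypothesis only gives some time for \<open>s\<close>; the
        empty path meets every bound, in particular the label \<open>t\<close> of the edge leaving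
        \<open>s\<close>.\<close>
      have "temporally_reachable G S s s t"
        using assms(1) S by (intro temporally_reachable_refl) auto
      then show ?thesis
        using start notin by (auto intro: temporally_reachable_step)
    next
      case finish
      then show ?thesis
        using step.IH S by (auto intro: temporally_reachable_step)
    qed
  qed
  have "\<not> Terminal s \<rightarrow>\<^sup>*\<^bsub>H\<^esub> Terminal z"
    using reach[of "Terminal z"] sep
    by (auto simp: temporally_reachable_def temporal_separator_def)
  moreover have "S' \<subseteq> pverts (flattening G s z) - {Terminal s, Terminal z}"
    using S by (auto simp: S'_def flattening_def inner_verts_def)
  ultimately show ?thesis
    unfolding digraph_separator_flattening_iff H_def S'_def by blast
qed

text \<open>If a vertex is outside the projected set, all its copies survive the deletion of
  \<open>S'\<close>, so waiting there is never blocked and a temporal walk avoiding that set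
  lifts.\<close>

lemma (in temporal_graph) temporal_separator_of_flattening_separator:
  assumes "s \<in> tverts G" and "s \<noteq> z" and no_sz: "\<forall>t. (s, z, t) \<notin> tedges G"
    and sep: "digraph_separator (with_proj (flattening G s z)) (Terminal s) (Terminal z) S'"
  shows "temporal_separator G s z {v. \<exists>i. Copy v i \<in> S'}"
proof -
  define S where "S = {v. \<exists>i. Copy v i \<in> S'}"
  define H where "H = with_proj (flattening G s z) \<restriction> (pverts (flattening G s z) - S')"
  have S': "S' \<subseteq> pverts (flattening G s z) - {Terminal s, Terminal z}"
    and unreach: "\<not> Terminal s \<rightarrow>\<^sup>*\<^bsub>H\<^esub> Terminal z"
    using sep unfolding digraph_separator_flattening_iff H_def by auto
  interpret H: wf_digraph H
    unfolding H_def by (intro wf_digraph.wellformed_induce_subgraph wf_digraph_flattening)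
  have dom: "x \<rightarrow>\<^bsub>H\<^esub> y \<longleftrightarrow> (x, y) \<in> parcs (flattening G s z) \<and>
      x \<in> pverts (flattening G s z) - S' \<and> y \<in> pverts (flattening G s z) - S'" for x y
    unfolding H_def by (rule dominates_induce_with_proj_iff)
  have terminals: "Terminal s \<in> pverts (flattening G s z) - S'"
      "Terminal z \<in> pverts (flattening G s z) - S'"
    using S' by (auto simp: flattening_def)
  have copy: "Copy v t \<in> pverts (flattening G s z) - S'"
    if "v \<in> inner_verts G s z" "v \<notin> S" "t \<in> {1..lifetime G}" for v t
    using that by (auto simp: S_def flattening_def)
  have wait: "Terminal s \<rightarrow>\<^sup>*\<^bsub>H\<^esub> Copy v t'"
    if "t \<le> t'" "Terminal s \<rightarrow>\<^sup>*\<^bsub>H\<^esub> Copy v t" "v \<in> inner_verts G s z" "v \<notin> S"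
      "1 \<le> t" "t' \<le> lifetime G" for v t t'
    using that
  proof (induction t' rule: dec_induct)
    case base
    then show ?case by simp
  next
    case (step i)
    then have "Copy v i \<rightarrow>\<^bsub>H\<^esub> Copy v (Suc i)"
      using copy[of v i] copy[of v "Suc i"] unfolding dom by (auto simp: flattening_def)
    moreover have "Terminal s \<rightarrow>\<^sup>*\<^bsub>H\<^esub> Copy v i"
      using step by auto
    ultimately show ?case
      by (rule H.reachable_adj_trans[rotated])
  qed
  \<comment> \<open>The lifting, by induction on the last edge. The claim covers every time from the
    last label on, so that the next edge can be taken at its own label. Since \<open>z\<close> is
    neither \<open>s\<close> nor inner, it also says that no such walk ends in
    \<open>z\<close>.\<close>
  have reach: "v = s \<or> v \<in> inner_verts G s z \<and>
      (\<forall>t \<in> {1..lifetime G}. (\<forall>(x, y, i) \<in> set es. i \<le> t) \<longrightarrow> Terminal s \<rightarrow>\<^sup>*\<^bsub>H\<^esub> Copy v t)"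
    if "underlying.awalk s es v" "sorted (map (\<lambda>(x, y, i). i) es)"
      "S \<inter> set (underlying.awalk_verts s es) = {}" for es v
    using that
  proof (induction es arbitrary: v rule: rev_induct)
    case Nil
    then show ?case by (simp add: underlying.awalk_Nil_iff)
  next
    case (snoc e es)
    obtain u v' t where "e = (u, v', t)"
      by (cases e)
    moreover from this snoc.prems(1) have "v' = v"
      by (auto simp: underlying.awalk_simps)
    ultimately have e: "e = (u, v, t)" by simp
    have walk: "underlying.awalk s es u" and "underlying.awalk u [e] v"
      and edge: "(u, v, t) \<in> tedges G" and "v \<in> tverts G"
      using snoc.prems(1) by (auto simp: e underlying.awalk_simps)
    have "S \<inter> (set (underlying.awalk_verts s es) \<union> {u, v}) = {}"
      using snoc.prems(3) underlying.set_awalk_verts_append[OF walk \<open>underlying.awalk u [e] v\<close>]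
      by (simp add: e)
    then have avoid: "S \<inter> set (underlying.awalk_verts s es) = {}" and "u \<notin> S" "v \<notin> S"
      by auto
    have sorted: "sorted (map (\<lambda>(x, y, i). i) es)" and times: "\<forall>(x, y, i) \<in> set es. i \<le> t"
      using snoc.prems(2) by (auto simp: e sorted_append)
    have t: "t \<in> {1..lifetime G}"
      using edge tedges_subset by auto
    \<comment> \<open>Sortedness makes the label \<open>t\<close> of the last edge an admissible
      time for the induction hypothesis.\<close>
    have u: "u = s \<or> u \<in> inner_verts G s z \<and> Terminal s \<rightarrow>\<^sup>*\<^bsub>H\<^esub> Copy u t"
      using snoc.IH[OF walk sorted avoid] t times by blast
    show ?case
    proof (cases "v = s")
      case False
      \<comment> \<open>A last edge into \<open>z\<close> cannot start at \<open>s\<close> by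
        \<open>no_sz\<close>; from an inner \<open>u\<close> it would give an arc from the reachable
        \<open>Copy u t\<close> to \<open>Terminal z\<close>.\<close>
      have "v \<noteq> z"
      proof
        assume "v = z"
        with u no_sz edge have u': "u \<in> inner_verts G s z" and "Terminal s \<rightarrow>\<^sup>*\<^bsub>H\<^esub> Copy u t"
          by auto
        moreover have "Copy u t \<rightarrow>\<^bsub>H\<^esub> Terminal z"
          using copy[OF u' \<open>u \<notin> S\<close> t] terminals(2) u' edge tedges_sym[of u z t] \<open>v = z\<close>
          unfolding dom by (auto simp: flattening_def)
        ultimately show False
          using unreach H.reachable_adj_trans by blast
      qed
      with False \<open>v \<in> tverts G\<close> have v: "v \<in> inner_verts G s z"
        by (simp add: inner_verts_def)
      have "Terminal s \<rightarrow>\<^sup>*\<^bsub>H\<^esub> Copy v t"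
        using u
      proof
        assume "u = s"
        then have "Terminal s \<rightarrow>\<^bsub>H\<^esub> Copy v t"
          using copy[OF v \<open>v \<notin> S\<close> t] terminals(1) v edge
          unfolding dom by (auto simp: flattening_def)
        then show ?thesis by (rule H.reachable_adjI)
      next
        assume u: "u \<in> inner_verts G s z \<and> Terminal s \<rightarrow>\<^sup>*\<^bsub>H\<^esub> Copy u t"
        then have "Copy u t \<rightarrow>\<^bsub>H\<^esub> Copy v t"
          using copy[OF _ \<open>u \<notin> S\<close> t] copy[OF v \<open>v \<notin> S\<close> t] v edge
          unfolding dom by (auto simp: flattening_def)
        with u show ?thesis
          using H.reachable_adj_trans by blast
      qed
      \<comment> \<open>Later copies of \<open>v\<close> are reached from \<open>Copy v t\<close>
        along waiting arcs.\<close>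
      then show ?thesis
        using wait[of t _ v] v \<open>v \<notin> S\<close> t by (auto simp: e)
    qed simp
  qed
  have "S \<inter> set (underlying.awalk_verts s es) \<noteq> {}" if "temporal_path G s es z" for es
    using reach[of es z] that \<open>s \<noteq> z\<close>
    by (auto simp: temporal_path_def inner_verts_def dest: underlying.awalkI_apath)
  moreover have "S \<subseteq> tverts G - {s, z}"
    using S' by (auto simp: S_def flattening_def inner_verts_def)
  ultimately show ?thesis
    by (simp add: temporal_separator_def S_def)
qed

text \<open>The second part excludes edges between \<open>s\<close> and \<open>z\<close>: such an
  edge is a temporal path that no set of inner vertices meets, so \<open>G\<close> would have no
  temporal separator, while the flattening has no arc for it and is separated by the set of all
  copies.\<close>

theorem theorem4:
  fixes G :: "'a temporal_graph" and s z :: 'a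
  assumes "temporal_graph G"
    and "s \<in> tverts G" and "z \<in> tverts G" and "s \<noteq> z"
  shows "(\<forall>S. temporal_separator G s z S \<longrightarrow>
            (\<exists>S'. digraph_separator (with_proj (flattening G s z)) (Terminal s) (Terminal z) S' \<and>
                  card S' \<le> lifetime G * card S)) \<and>
         ((\<forall>t. (s, z, t) \<notin> tedges G) \<longrightarrow>
          (\<forall>S'. digraph_separator (with_proj (flattening G s z)) (Terminal s) (Terminal z) S' \<longrightarrow>
            (\<exists>S. temporal_separator G s z S \<and> card S \<le> card S')))"
proof -
  interpret temporal_graph G by fact
  have "\<exists>S'. digraph_separator (with_proj (flattening G s z)) (Terminal s) (Terminal z) S' \<and>
      card S' \<le> lifetime G * card S" if S: "temporal_separator G s z S" for S
  proof -
    have "finite (S \<times> {1..lifetime G})"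
      using S finite_tverts by (auto simp: temporal_separator_def intro: finite_subset)
    then have "card (case_prod Copy ` (S \<times> {1..lifetime G})) \<le> lifetime G * card S"
      using card_image_le[of "S \<times> {1..lifetime G}" "case_prod Copy"]
      by (simp add: card_cartesian_product mult.commute)
    then show ?thesis
      using flattening_separator_of_temporal_separator[OF assms(2,4) S] by blast
  qed
  moreover have "\<exists>S. temporal_separator G s z S \<and> card S \<le> card S'"
    if no_sz: "\<forall>t. (s, z, t) \<notin> tedges G"
      and S': "digraph_separator (with_proj (flattening G s z)) (Terminal s) (Terminal z) S'" for S'
  proof -
    \<comment> \<open>The image form exhibits finiteness, which rules out an infinite
      \<open>S'\<close>, whose \<open>card\<close> would be 0.\<close>
    have "pverts (flattening G s z) =
        {Terminal s, Terminal z} \<union> case_prod Copy ` (inner_verts G s z \<times> {1..lifetime G})"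
      by (auto simp: flattening_def)
    then have "finite (pverts (flattening G s z))"
      using finite_tverts by (simp add: inner_verts_def)
    then have "finite S'"
      using S' by (auto simp: digraph_separator_def intro: finite_subset)
    \<comment> \<open>The map forgets time indices; \<open>id\<close> makes it total on terminals,
      none of which lies in \<open>S'\<close>.\<close>
    moreover have "{v. \<exists>i. Copy v i \<in> S'} \<subseteq> case_flat_vertex id (\<lambda>v i. v) ` S'"
      by force
    ultimately have "card {v. \<exists>i. Copy v i \<in> S'} \<le> card S'"
      by (rule surj_card_le)
    then show ?thesis
      using temporal_separator_of_flattening_separator[OF assms(2,4) no_sz S'] by blast
  qed
  ultimately show ?thesis by blast
qed

end
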